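(* Let $\beta,\gamma>0$ and $x,y\in(0,1)$, and put $$U=\frac{\beta x+\gamma y}{\beta+\gamma},\qquad V=\frac{\beta x+\gamma(1-y)}{\beta+\gamma}.$$ Assume $U,V\in(0,1)$. Then $$\min\{\sin^{\beta+\gamma}(\pi U),\sin^{\beta+\gamma}(\pi V)\}=\begin{cases}\sin^{\beta+\gamma}(\pi U),&\text{if }(1-2y)(2x-1)\leq0,\\ \sin^{\beta+\gamma}(\pi V),&\text{if }(1-2y)(2x-1)\geq0.\end{cases}$$ Moreover, equality $\sin(\pi U)=\sin(\pi V)$ occurs when $y=\frac12$ (in which case $U=V$) or $x=\frac12$ (in which case $U=1-V$).
   Context: Here $\sin^{c}(t)$ denotes $(\sin t)^c$. *)

theory Defs
  imports Complex_Main
begin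

end

theory Submission imports Defs begin

text \<open>
  The factorisation \<open>sin (\<pi>U) - sin (\<pi>V) = 2 sin (\<pi>(U - V)/2) sin (\<pi>(1 - U - V)/2)\<close> has
  both arguments in \<open>(-\<pi>/2, \<pi>/2)\<close>, where sine preserves signs, and \<open>U - V\<close> and
  \<open>1 - U - V\<close> are positive multiples of \<open>2y - 1\<close> and \<open>1 - 2x\<close>.
\<close>

text \<open>Sine is positive on \<open>(0, pi)\<close>, which covers positive \<open>s\<close>;
  oddness of sine transfers this to negative \<open>s\<close>.\<close>

lemma sgn_sin_half:
  fixes s :: real
  assumes "\<bar>s\<bar> < 1"
  shows "sgn (sin (pi * s / 2)) = sgn s"
proof -
  have pos: "sin (pi * t / 2) > 0" if "0 < t" "t < 1" for t :: real
  proof (rule sin_gt_zero)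
    show "0 < pi * t / 2" using that by simp
    have "pi * t < pi * 1" using that by simp
    then show "pi * t / 2 < pi" using pi_gt_zero by linarith
  qed
  show ?thesis
  proof (cases s "0 :: real" rule: linorder_cases)
    case less
    then have "sin (pi * s / 2) < 0" using pos[of "- s"] assms by simp
    then show ?thesis using less by simp
  next
    case greater
    then show ?thesis using pos[of s] assms by simp
  qed simp
qed

text \<open>Taking signs in the sum-to-product formula replaces each sine factor by its linear
  argument.\<close>

lemma sgn_sin_diff:
  fixes u v :: real
  assumes "u \<in> {0<..<1}" and "v \<in> {0<..<1}"
  shows "sgn (sin (pi * u) - sin (pi * v)) = sgn ((1 - u - v) * (u - v))"
proof -
  \<comment> \<open>Passing to the complementary angle makes both factors sines, so
    \<open>sgn_sin_half\<close> handles each of them.\<close>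
  have c: "cos ((pi * u + pi * v) / 2) = sin (pi * (1 - u - v) / 2)"
    by (simp add: sin_cos_eq algebra_simps diff_divide_distrib add_divide_distrib)
  have "sin (pi * u) - sin (pi * v)
      = 2 * sin (pi * (u - v) / 2) * sin (pi * (1 - u - v) / 2)"
    unfolding sin_diff_sin c by (simp add: right_diff_distrib)
  moreover have "\<bar>1 - u - v\<bar> < 1" "\<bar>u - v\<bar> < 1" using assms by auto
  ultimately show ?thesis by (simp add: sgn_mult sgn_sin_half)
qed

theorem corollary4p2:
  fixes \<beta> \<gamma> x y U V :: real
  assumes "\<beta> > 0" and "\<gamma> > 0"
    and "x \<in> {0<..<1}" and "y \<in> {0<..<1}"
    and "U = (\<beta> * x + \<gamma> * y) / (\<beta> + \<gamma>)"
    and "V = (\<beta> * x + \<gamma> * (1 - y)) / (\<beta> + \<gamma>)"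
    and "U \<in> {0<..<1}" and "V \<in> {0<..<1}"
  shows "((1 - 2 * y) * (2 * x - 1) \<le> 0 \<longrightarrow>
            min (sin (pi * U) powr (\<beta> + \<gamma>)) (sin (pi * V) powr (\<beta> + \<gamma>))
              = sin (pi * U) powr (\<beta> + \<gamma>))
       \<and> ((1 - 2 * y) * (2 * x - 1) \<ge> 0 \<longrightarrow>
            min (sin (pi * U) powr (\<beta> + \<gamma>)) (sin (pi * V) powr (\<beta> + \<gamma>))
              = sin (pi * V) powr (\<beta> + \<gamma>))
       \<and> (sin (pi * U) = sin (pi * V) \<longleftrightarrow> y = 1 / 2 \<or> x = 1 / 2)
       \<and> (y = 1 / 2 \<longrightarrow> U = V)
       \<and> (x = 1 / 2 \<longrightarrow> U = 1 - V)"
proof -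
  define p where "p = (1 - 2 * y) * (2 * x - 1)"
  \<comment> \<open>The \<open>y\<close> terms cancel in \<open>U + V\<close>, and the
    \<open>x\<close> terms in \<open>U - V\<close>.\<close>
  have sum: "1 - U - V = \<beta> / (\<beta> + \<gamma>) * (1 - 2 * x)"
    and diff: "U - V = \<gamma> / (\<beta> + \<gamma>) * (2 * y - 1)"
    using assms(1,2,5,6) by (simp_all add: field_simps)
  have "(1 - U - V) * (U - V) = (\<beta> / (\<beta> + \<gamma>) * (\<gamma> / (\<beta> + \<gamma>))) * p"
  proof -
    have "p = (1 - 2 * x) * (2 * y - 1)"
      unfolding p_def by (simp add: algebra_simps)
    then show ?thesis unfolding sum diff by (simp only: mult_ac)
  qed
  \<comment> \<open>The factor in front of \<open>p\<close> is positive, so it drops out of the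
    sign.\<close>
  then have sgn: "sgn (sin (pi * U) - sin (pi * V)) = sgn p"
    using sgn_sin_diff[OF assms(7,8)] assms(1,2) by (simp add: sgn_mult)
  have nonneg: "0 \<le> sin (pi * U)" "0 \<le> sin (pi * V)"
    using assms(7,8) by (auto intro!: sin_ge_zero)
  \<comment> \<open>The sign of \<open>p\<close> orders the two sines; a positive exponent preserves
    the order of nonnegative bases.\<close>
  have U_le: "sin (pi * U) powr (\<beta> + \<gamma>) \<le> sin (pi * V) powr (\<beta> + \<gamma>)" if "p \<le> 0"
    using that sgn nonneg assms(1,2)
    by (intro powr_mono2) (auto simp: sgn_if split: if_splits)
  have V_le: "sin (pi * V) powr (\<beta> + \<gamma>) \<le> sin (pi * U) powr (\<beta> + \<gamma>)" if "p \<ge> 0"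
    using that sgn nonneg assms(1,2)
    by (intro powr_mono2) (auto simp: sgn_if split: if_splits)
  \<comment> \<open>A real number vanishes exactly when its sign does; the two linear factors of
    \<open>p\<close> then give the two cases.\<close>
  have "sin (pi * U) = sin (pi * V) \<longleftrightarrow> p = 0"
    using sgn by (metis right_minus_eq sgn_0_0)
  then have eq: "sin (pi * U) = sin (pi * V) \<longleftrightarrow> y = 1 / 2 \<or> x = 1 / 2"
    unfolding p_def by auto
  have "U = V" if "y = 1 / 2" using diff that by simp
  moreover have "U = 1 - V" if "x = 1 / 2" using sum that by simp
  ultimately show ?thesis
    using U_le V_le eq unfolding p_def by (auto simp: min_absorb1 min_absorb2)
qed

end
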